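(* For all integers $d$ and $n$ such that $dn$ is even, $d \ge 5$ and $n \ge 2d+3$, there exists a connected $d$-regular finite simple graph $G$ on $n$ vertices that requires at least $d+2$ colors to be acyclically edge colored, i.e. $a'(G) \ge d+2$.
   Context: All graphs are finite and simple. A proper edge coloring of a graph $G=(V,E)$ is a map $c:E\to C$ ($C$ a set of colors) with $c(e)\neq c(f)$ for any two distinct adjacent edges $e,f$ (edges sharing an endpoint). A proper edge coloring is acyclic if there is no bichromatic cycle, i.e. no cycle of $G$ whose edges use only two colors; equivalently, the union of any two color classes induces a linear forest (a disjoint union of paths). The acyclic chromatic index $a'(G)$ is the minimum number of colors in an acyclic edge coloring of $G$. *)

theory Defs
  imports "Graph_Theory.Digraph_Component" "Graph_Theory.Pair_Digraph"
begin

text \<open>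
  A finite simple graph is a \<^locale>\<open>pair_graph\<close>: a finite, loopfree, symmetric digraph
  whose arcs are pairs of vertices. The undirected edge \<open>{u, v}\<close> is represented by the two arcs
  \<open>(u, v)\<close> and \<open>(v, u)\<close>, so the degree of a vertex is its out-degree.
  Colors are assigned to undirected edges.
\<close>

abbreviation edge_of :: "'a \<times> 'a \<Rightarrow> 'a set" where
  "edge_of a \<equiv> {fst a, snd a}"

definition edges :: "'a pair_pre_digraph \<Rightarrow> 'a set set" where
  "edges G = edge_of ` parcs G"

definition regular :: "nat \<Rightarrow> 'a pair_pre_digraph \<Rightarrow> bool" where
  "regular d G \<longleftrightarrow> (\<forall>v \<in> pverts G. out_degree (with_proj G) v = d)"

definition proper_edge_coloring :: "'a pair_pre_digraph \<Rightarrow> ('a set \<Rightarrow> 'c) \<Rightarrow> bool" where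
  "proper_edge_coloring G c \<longleftrightarrow>
     (\<forall>e \<in> edges G. \<forall>f \<in> edges G. e \<noteq> f \<and> e \<inter> f \<noteq> {} \<longrightarrow> c e \<noteq> c f)"

text \<open>
  The predicate \<^const>\<open>pre_digraph.cycle\<close> also accepts \<open>u, v, u\<close> in a symmetric digraph;
  the lower bound on the length leaves exactly the cycles of the undirected graph.
\<close>

definition bichromatic_cycle ::
    "'a pair_pre_digraph \<Rightarrow> ('a set \<Rightarrow> 'c) \<Rightarrow> ('a \<times> 'a) awalk \<Rightarrow> bool" where
  "bichromatic_cycle G c p \<longleftrightarrow>
     pre_digraph.cycle (with_proj G) p \<and> 3 \<le> length p \<and>
     (\<exists>a b. \<forall>e \<in> set p. c (edge_of e) \<in> {a, b})"

definition acyclic_edge_coloring :: "'a pair_pre_digraph \<Rightarrow> ('a set \<Rightarrow> 'c) \<Rightarrow> bool" where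
  "acyclic_edge_coloring G c \<longleftrightarrow>
     proper_edge_coloring G c \<and> \<not> (\<exists>p. bichromatic_cycle G c p)"

definition acyclic_edge_colorable :: "'a pair_pre_digraph \<Rightarrow> nat \<Rightarrow> bool" where
  "acyclic_edge_colorable G k \<longleftrightarrow>
     (\<exists>c :: 'a set \<Rightarrow> nat. c ` edges G \<subseteq> {..<k} \<and> acyclic_edge_coloring G c)"

definition acyclic_chromatic_index :: "'a pair_pre_digraph \<Rightarrow> nat" where
  "acyclic_chromatic_index G = (LEAST k. acyclic_edge_colorable G k)"

text \<open>
  The minimum exists for every finite simple graph: coloring all edges differently is acyclic.
\<close>

lemma inj_acyclic_edge_coloring:
  assumes "inj_on c (edges G)"
  shows "acyclic_edge_coloring G c"
proof -
  have "\<not> bichromatic_cycle G c p" for p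
  proof
    assume B: "bichromatic_cycle G c p"
    then have len: "3 \<le> length p" and cyc: "pre_digraph.cycle (with_proj G) p"
      by (auto simp: bichromatic_cycle_def)
    obtain a b where ab: "\<forall>e \<in> set p. c (edge_of e) \<in> {a, b}"
      using B unfolding bichromatic_cycle_def by blast
    obtain e1 e2 e3 q where p: "p = e1 # e2 # e3 # q"
      using len by (auto simp: numeral_3_eq_3 Suc_le_length_iff)
    obtain u where walk: "pre_digraph.awalk (with_proj G) u p u"
      and dist: "distinct (tl (pre_digraph.awalk_verts (with_proj G) u p))"
      using cyc unfolding pre_digraph.cycle_def by blast
    have sub: "set p \<subseteq> parcs G" and cas: "pcas u p u"
      using walk by (auto simp: pre_digraph.awalk_def cas_with_proj_eq)
    have last: "pcas x r y \<Longrightarrow> y \<in> set (pawalk_verts x r)" for x y r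
      by (induct r arbitrary: x) auto
    have d: "distinct (tl (pawalk_verts u p))"
      using dist by (simp add: awalk_verts_with_proj_eq)
    have c1: "fst e1 = u" "fst e2 = snd e1" "fst e3 = snd e2" "pcas (snd e3) q u"
      using cas p by auto
    have hd: "pawalk_verts x r = x # tl (pawalk_verts x r)"
      if "pcas x r u" for x r
      using that by (cases r) auto
    have u_in: "u \<in> set (pawalk_verts (snd e3) q)" using last[OF c1(4)] .
    have e3_in: "snd e3 \<in> set (pawalk_verts (snd e3) q)" using hd[OF c1(4)]
      by (metis list.set_intros(1))
    have dd: "snd e1 \<noteq> snd e2" "snd e1 \<notin> set (pawalk_verts (snd e3) q)"
      "snd e2 \<notin> set (pawalk_verts (snd e3) q)"
      using d c1 unfolding p by auto
    have ne: "edge_of e1 \<noteq> edge_of e2" "edge_of e2 \<noteq> edge_of e3" "edge_of e1 \<noteq> edge_of e3"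
      using dd u_in e3_in c1 by (auto simp: doubleton_eq_iff)
    have "edge_of e1 \<in> edges G" "edge_of e2 \<in> edges G" "edge_of e3 \<in> edges G"
      using sub p by (auto simp: edges_def)
    then have "c (edge_of e1) \<noteq> c (edge_of e2)" "c (edge_of e2) \<noteq> c (edge_of e3)"
      "c (edge_of e1) \<noteq> c (edge_of e3)"
      using ne assms by (meson inj_onD)+
    moreover have "c (edge_of e1) \<in> {a, b}" "c (edge_of e2) \<in> {a, b}" "c (edge_of e3) \<in> {a, b}"
      using ab p by auto
    ultimately show False by (metis insertE singletonD)
  qed
  then show ?thesis
    using assms unfolding acyclic_edge_coloring_def proper_edge_coloring_def
    by (auto dest: inj_onD)
qed

lemma acyclic_chromatic_index_colorable:
  assumes "pair_graph G"
  shows "acyclic_edge_colorable G (acyclic_chromatic_index G)"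
proof -
  interpret pair_graph G by fact
  have "finite (edges G)" by (simp add: edges_def pair_finite_arcs)
  then obtain c :: "'a set \<Rightarrow> nat" where c: "c ` edges G = {..<card (edges G)}" "inj_on c (edges G)"
    using ex_bij_betw_finite_nat[of "edges G"]
    by (auto simp: bij_betw_def atLeast0LessThan)
  then have "acyclic_edge_colorable G (card (edges G))"
    unfolding acyclic_edge_colorable_def
    by (intro exI[of _ c] conjI inj_acyclic_edge_coloring) simp_all
  then show ?thesis unfolding acyclic_chromatic_index_def by (rule LeastI)
qed

end

theory Submission
  imports Defs
begin

text \<open>
  Two color classes that are both perfect matchings on the same vertex set form a
  \<open>2\<close>-regular graph, which contains a cycle. Hence an acyclic edge coloring
  restricted to \<open>2 * k\<close> vertices has at most one class with \<open>k\<close> edges, and all others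
  have at most \<open>k - 1\<close>: with \<open>q\<close> colors the set spans at most \<open>q * (k - 1) + 1\<close> edges
  (\<open>card_edges_within_le\<close>). If the graph is \<open>d\<close>-regular and only two edges leave the set, the
  set spans at least \<open>k * d - 1\<close> edges. For \<open>q = d + 1\<close> the two bounds give \<open>d \<le> k + 1\<close>. So a
  \<open>d\<close>-regular graph with such a nearly isolated set and \<open>k + 2 \<le> d\<close> has acyclic chromatic
  index at least \<open>d + 2\<close> (\<open>acyclic_chromatic_index_ge_if_small_cut\<close>).

  It remains to attach a small dense piece to a regular graph of the right size. The piece has
  \<open>2 * k\<close> vertices, where \<open>2 * k\<close> is \<open>d + 1\<close> or \<open>d + 2\<close>, the smallest even number above \<open>d\<close>;
  then \<open>k + 2 \<le> d\<close> says exactly \<open>d \<ge> 5\<close>, and \<open>n \<ge> 2 * d + 3\<close> leaves at least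
  \<open>d + 1\<close> vertices for the rest. Both parts are circulant graphs, each containing its Hamiltonian
  cycle of consecutive numbers. Removing from each part the edge that closes this cycle, and joining
  the four ends crosswise, preserves all degrees, creates just two edges between the parts, and
  merges the two cycles into one Hamiltonian cycle, so that the result is connected
  (\<open>ex_regular_connected_with_small_cut\<close>).
\<close>

section \<open>Edges spanned by a vertex set in an acyclic edge coloring\<close>

text \<open>
  Extremal argument: all neighbors of the start of a longest path lie on that path. One of them is
  not the second vertex of the path, and the arc from it back to the start closes a cycle that
  avoids the degenerate closed walk \<open>u, v, u\<close>.
\<close>

lemma ex_cycle_if_two_le_out_degree:
  assumes "pair_graph G" and "pverts G \<noteq> {}"
    and deg: "\<And>v. v \<in> pverts G \<Longrightarrow> 2 \<le> out_degree (with_proj G) v"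
  shows "\<exists>p. pre_digraph.cycle (with_proj G) p \<and> 3 \<le> length p"
proof -
  interpret pair_graph G by fact
  define L where "L = {length p | u p v. apath u p v}"
  have "L = (\<lambda>(u, p, v). length p) ` {(u, p, v). apath u p v}"
    unfolding L_def by force
  then have fin: "finite L" using apaths_finite_triple by simp
  obtain v0 where "v0 \<in> pverts G" using assms(2) by blast
  then have "apath v0 [] v0" by (simp add: apath_Nil_iff)
  then have "L \<noteq> {}" unfolding L_def by blast
  with fin have "Max L \<in> L" by (rule Max_in)
  then obtain u p v where p: "apath u p v" and len: "length p = Max L"
    unfolding L_def by auto
  have maximal: "length q \<le> length p" if "apath x q y" for x q y
    unfolding len by (rule Max_ge[OF fin]) (use that in \<open>auto simp: L_def\<close>)
  have walk: "awalk u p v" using p by (auto simp: apath_def)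
  then have u: "u \<in> pverts G" by auto
  \<comment> \<open>The vertex after \<open>u\<close> on the path. The empty path contains no neighbor of \<open>u\<close>, since there
    are no loops, so any value will do there.\<close>
  define w where "w = (case p of [] \<Rightarrow> u | e # _ \<Rightarrow> snd e)"
  have "\<not> out_arcs (with_proj G) u \<subseteq> {(u, w)}"
    using deg[OF u] card_mono[of "{(u, w)}" "out_arcs (with_proj G) u"]
    unfolding out_degree_def by auto
  then have "\<exists>y. (u, y) \<in> parcs G \<and> y \<noteq> w" by (auto simp: out_arcs_def)
  then obtain y where uy: "(u, y) \<in> parcs G" and "y \<noteq> w" by blast
  have yu: "(y, u) \<in> parcs G" using uy by (rule arcs_symmetric)
  have "\<not> apath y ((y, u) # p) v"
    using maximal[of y "(y, u) # p" v] by auto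
  then have "y \<in> set (awalk_verts u p)"
    using p yu by (simp add: apath_Cons_iff)
  then obtain q r where qr: "p = q @ r" "awalk u q y"
    using awalk_decomp[OF walk] by blast
  have "apath u q y"
    using p qr apath_append_iff[of u q r v] by (metis awalk_ends_eqD apath_def)
  then have dist: "distinct (awalk_verts u q)" by (simp add: apath_def)
  have "y \<noteq> u" using uy no_loops' by blast
  have "2 \<le> length q"
  proof (rule ccontr)
    assume "\<not> 2 \<le> length q"
    then consider "q = []" | e where "q = [e]" by (cases q; cases "tl q") auto
    then show False
    proof cases
      case 1
      then show False using qr(2) \<open>y \<noteq> u\<close> by (simp add: awalk_Nil_iff)
    next
      case 2
      then have "snd e = y" using qr(2) by (simp add: awalk_simps)
      then show False using 2 qr(1) \<open>y \<noteq> w\<close> by (simp add: w_def)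
    qed
  qed
  then have "3 \<le> length ((y, u) # q)" by simp
  moreover have "cycle ((y, u) # q)"
    unfolding cycle_def using yu qr(2) dist by (auto simp: awalk_Cons_iff)
  ultimately show ?thesis by blast
qed

text \<open>
  Within \<open>W\<close>, the two colors provide every vertex with two different neighbors, so the arcs of these
  colors contain a cycle.
\<close>

lemma bichromatic_cycle_if_two_perfect_classes:
  assumes "pair_graph G" and "finite W" "W \<noteq> {}" "W \<subseteq> pverts G" and "\<alpha> \<noteq> \<beta>"
    and cover: "\<And>\<gamma>. \<gamma> \<in> {\<alpha>, \<beta>} \<Longrightarrow> \<Union>{e \<in> edges G. e \<subseteq> W \<and> c e = \<gamma>} = W"
  shows "\<exists>p. bichromatic_cycle G c p"
proof -
  interpret pair_graph G by fact
  define A where "A = {a \<in> parcs G. edge_of a \<subseteq> W \<and> c (edge_of a) \<in> {\<alpha>, \<beta>}}"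
  define K where "K = \<lparr>pverts = W, parcs = A\<rparr>"
  have finA: "finite A" unfolding A_def using pair_finite_arcs by simp
  interpret K: pair_graph K
  proof
    show "symmetric (with_proj K)"
      unfolding symmetric_def by (rule symI)
        (auto simp: K_def A_def insert_commute intro: arcs_symmetric)
  qed (use \<open>finite W\<close> finA in \<open>auto simp: K_def A_def dest: pair_no_loops\<close>)
  have nbr: "\<exists>y. (v, y) \<in> A \<and> c {v, y} = \<gamma>" if v: "v \<in> W" and "\<gamma> \<in> {\<alpha>, \<beta>}" for v \<gamma>
  proof -
    obtain e where e: "e \<in> edges G" "e \<subseteq> W" "c e = \<gamma>" "v \<in> e"
      using cover[OF \<open>\<gamma> \<in> _\<close>] v by blast
    then obtain x y where xy: "(x, y) \<in> parcs G" "e = {x, y}" by (auto simp: edges_def)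
    then have "(y, x) \<in> parcs G" by (blast intro: arcs_symmetric)
    with xy e \<open>\<gamma> \<in> _\<close> show ?thesis unfolding A_def by (auto simp: insert_commute)
  qed
  have "2 \<le> out_degree (with_proj K) v" if "v \<in> pverts K" for v
  proof -
    from that have "v \<in> W" by (simp add: K_def)
    obtain y where y: "(v, y) \<in> A" "c {v, y} = \<alpha>" using nbr[OF \<open>v \<in> W\<close>] by blast
    obtain z where z: "(v, z) \<in> A" "c {v, z} = \<beta>" using nbr[OF \<open>v \<in> W\<close>] by blast
    have "y \<noteq> z" using y z \<open>\<alpha> \<noteq> \<beta>\<close> by auto
    then have "2 = card {(v, y), (v, z)}" by simp
    also have "\<dots> \<le> card (out_arcs (with_proj K) v)"
      by (rule card_mono) (use finA y z in \<open>auto simp: out_arcs_def K_def\<close>)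
    finally show ?thesis by (simp add: out_degree_def)
  qed
  then obtain p where p: "K.cycle p" "3 \<le> length p"
    using ex_cycle_if_two_le_out_degree[OF K.pair_graph] \<open>W \<noteq> {}\<close> by (auto simp: K_def)
  have "set p \<subseteq> parcs K" using p(1) unfolding K.cycle_def K.awalk_def by blast
  then have sub: "set p \<subseteq> A" by (simp add: K_def)
  have cyc: "cycle p"
    using p(1) sub \<open>W \<subseteq> pverts G\<close> unfolding K.cycle_def cycle_def K.awalk_def awalk_def
    by (auto simp: K_def A_def)
  have col: "c (edge_of a) \<in> {\<alpha>, \<beta>}" if "a \<in> set p" for a
  proof -
    from that sub have "a \<in> A" by (rule rev_subsetD)
    then show ?thesis by (simp add: A_def)
  qed
  have "\<forall>a\<in>set p. c (edge_of a) \<in> {\<alpha>, \<beta>}" using col by (rule ballI)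
  then have "\<exists>x y. \<forall>a\<in>set p. c (edge_of a) \<in> {x, y}" by (intro exI)
  with cyc p(2) have "bichromatic_cycle G c p"
    unfolding bichromatic_cycle_def by (intro conjI)
  then show ?thesis ..
qed

text \<open>
  Every color class inside \<open>W\<close> is a matching. It has at most \<open>k\<close> edges, with equality only if it
  covers \<open>W\<close>, and two covering classes would produce a bichromatic cycle.
\<close>

lemma card_edges_within_le:
  fixes c :: "'a set \<Rightarrow> nat"
  assumes "pair_graph G" and W: "W \<subseteq> pverts G" "card W = 2 * k" "0 < k"
    and col: "c ` edges G \<subseteq> {..<q}" and acyc: "acyclic_edge_coloring G c"
  shows "card {e \<in> edges G. e \<subseteq> W} \<le> q * (k - 1) + 1"
proof -
  interpret pair_graph G by fact
  have finW: "finite W" using W(1) pair_finite_verts finite_subset by blast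
  have finE: "finite (edges G)" by (simp add: edges_def pair_finite_arcs)
  define M where "M \<gamma> = {e \<in> edges G. e \<subseteq> W \<and> c e = \<gamma>}" for \<gamma>
  have finM: "finite (M \<gamma>)" for \<gamma> using finE by (simp add: M_def)
  have sub: "\<Union>(M \<gamma>) \<subseteq> W" for \<gamma> by (auto simp: M_def)
  have two: "2 * card (M \<gamma>) = card (\<Union>(M \<gamma>))" for \<gamma>
  proof (rule card_partition[OF finM])
    show "finite (\<Union>(M \<gamma>))" using sub finW by (rule finite_subset)
    show "card e = 2" if "e \<in> M \<gamma>" for e
      using that by (auto simp: M_def edges_def dest: pair_no_loops)
    show "e \<inter> f = {}" if "e \<in> M \<gamma>" "f \<in> M \<gamma>" "e \<noteq> f" for e f
      using that acyc unfolding acyclic_edge_coloring_def proper_edge_coloring_def M_def by blast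
  qed
  have le: "card (M \<gamma>) \<le> k" for \<gamma>
    using two[of \<gamma>] card_mono[OF finW sub, of \<gamma>] W(2) by simp
  have perfect: "\<Union>(M \<gamma>) = W" if "card (M \<gamma>) = k" for \<gamma>
    by (rule card_subset_eq[OF finW sub]) (use two[of \<gamma>] that W(2) in simp)
  have unique: "\<alpha> = \<beta>" if "card (M \<alpha>) = k" "card (M \<beta>) = k" for \<alpha> \<beta>
  proof (rule ccontr)
    assume "\<alpha> \<noteq> \<beta>"
    have "W \<noteq> {}" using W by auto
    have "\<exists>p. bichromatic_cycle G c p"
      by (rule bichromatic_cycle_if_two_perfect_classes[OF \<open>pair_graph G\<close> finW \<open>W \<noteq> {}\<close> W(1) \<open>\<alpha> \<noteq> \<beta>\<close>])
        (use perfect that in \<open>auto simp: M_def\<close>)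
    then show False using acyc by (simp add: acyclic_edge_coloring_def)
  qed
  define P where "P = {\<gamma>. \<gamma> < q \<and> card (M \<gamma>) = k}"
  have "finite P" by (simp add: P_def)
  then have "card P \<le> 1" by (rule card_le_Suc0_iff_eq[THEN iffD2, unfolded One_nat_def[symmetric]])
      (auto simp: P_def intro: unique)
  have "{e \<in> edges G. e \<subseteq> W} = (\<Union>\<gamma><q. M \<gamma>)"
    using col by (auto simp: M_def)
  then have "card {e \<in> edges G. e \<subseteq> W} \<le> (\<Sum>\<gamma><q. card (M \<gamma>))"
    using card_UN_le[of "{..<q}" M] by simp
  also have "\<dots> \<le> (\<Sum>\<gamma><q. (k - 1) + (if \<gamma> \<in> P then 1 else 0))"
  proof (rule sum_mono)
    fix \<gamma> assume "\<gamma> \<in> {..<q}"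
    then show "card (M \<gamma>) \<le> (k - 1) + (if \<gamma> \<in> P then 1 else 0)"
      using le[of \<gamma>] \<open>0 < k\<close> by (auto simp: P_def)
  qed
  also have "\<dots> = q * (k - 1) + card ({..<q} \<inter> P)"
    by (simp add: sum.distrib sum.If_cases)
  also have "{..<q} \<inter> P = P" by (auto simp: P_def)
  finally show ?thesis using \<open>card P \<le> 1\<close> by linarith
qed

text \<open>
  Degrees count arcs whereas colors live on edges; this inequality translates between the two.
\<close>

lemma card_arcs_within_le:
  assumes "pair_graph G"
  shows "card {a \<in> parcs G. edge_of a \<subseteq> W} \<le> 2 * card {e \<in> edges G. e \<subseteq> W}"
proof -
  interpret pair_graph G by fact
  let ?E = "{e \<in> edges G. e \<subseteq> W}"
  have finE: "finite ?E" by (simp add: edges_def pair_finite_arcs)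
  have "card {a \<in> parcs G. edge_of a \<subseteq> W} \<le> card (\<Union>e\<in>?E. {a \<in> parcs G. edge_of a = e})"
  proof (rule card_mono)
    show "finite (\<Union>e\<in>?E. {a \<in> parcs G. edge_of a = e})"
      by (rule finite_subset[OF _ pair_finite_arcs]) blast
    show "{a \<in> parcs G. edge_of a \<subseteq> W} \<subseteq> (\<Union>e\<in>?E. {a \<in> parcs G. edge_of a = e})"
      unfolding edges_def by blast
  qed
  also have "\<dots> \<le> (\<Sum>e\<in>?E. card {a \<in> parcs G. edge_of a = e})"
    by (rule card_UN_le[OF finE])
  also have "\<dots> \<le> (\<Sum>e\<in>?E. 2)"
  proof (rule sum_mono)
    fix e assume "e \<in> ?E"
    then obtain x y where "e = {x, y}" by (auto simp: edges_def)
    then have "{a \<in> parcs G. edge_of a = e} \<subseteq> {(x, y), (y, x)}"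
      by (auto simp: doubleton_eq_iff)
    then have "card {a \<in> parcs G. edge_of a = e} \<le> card {(x, y), (y, x)}"
      by (intro card_mono) auto
    also have "\<dots> \<le> 2" using card_length[of "[(x, y), (y, x)]"] by simp
    finally show "card {a \<in> parcs G. edge_of a = e} \<le> 2" .
  qed
  finally show ?thesis by simp
qed

text \<open>
  Counting the \<open>2 * k * d\<close> arcs that start in \<open>W\<close>: at most two leave \<open>W\<close>, the others come from
  edges within \<open>W\<close>. With \<open>d + 1\<close> colors there are too few of those.
\<close>

lemma acyclic_chromatic_index_ge_if_small_cut:
  assumes "pair_graph G" and reg: "regular d G"
    and W: "W \<subseteq> pverts G" "card W = 2 * k" "0 < k"
    and cut: "card {a \<in> parcs G. fst a \<in> W \<and> snd a \<notin> W} \<le> 2"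
    and "k + 2 \<le> d"
  shows "d + 2 \<le> acyclic_chromatic_index G"
proof (rule ccontr)
  interpret pair_graph G by fact
  assume "\<not> d + 2 \<le> acyclic_chromatic_index G"
  then have "acyclic_chromatic_index G \<le> d + 1" by simp
  with acyclic_chromatic_index_colorable[OF \<open>pair_graph G\<close>]
  obtain c :: "'a set \<Rightarrow> nat" where c: "c ` edges G \<subseteq> {..<d + 1}" "acyclic_edge_coloring G c"
    unfolding acyclic_edge_colorable_def by (meson lessThan_subset_iff subset_trans)
  have finW: "finite W" using W(1) pair_finite_verts finite_subset by blast
  have "2 * k * d = (\<Sum>v\<in>W. card {a \<in> parcs G. fst a = v})"
    using reg W by (simp add: regular_def out_degree_def out_arcs_def subset_eq)
  also have "\<dots> = card (\<Union>v\<in>W. {a \<in> parcs G. fst a = v})"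
    by (rule card_UN_disjoint[symmetric]) (use finW pair_finite_arcs in auto)
  also have "(\<Union>v\<in>W. {a \<in> parcs G. fst a = v}) =
      {a \<in> parcs G. edge_of a \<subseteq> W} \<union> {a \<in> parcs G. fst a \<in> W \<and> snd a \<notin> W}"
    by auto
  also have "card \<dots> \<le> card {a \<in> parcs G. edge_of a \<subseteq> W} + 2"
    by (rule order.trans[OF card_Un_le]) (use cut in simp)
  also have "\<dots> \<le> 2 * card {e \<in> edges G. e \<subseteq> W} + 2"
    using card_arcs_within_le[OF \<open>pair_graph G\<close>] by simp
  also have "\<dots> \<le> 2 * ((d + 1) * (k - 1) + 1) + 2"
    using card_edges_within_le[OF \<open>pair_graph G\<close> W c] by simp
  finally have "k * d \<le> (d + 1) * (k - 1) + 2" by simp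
  moreover obtain j where "k = Suc j" using \<open>0 < k\<close> by (cases k) auto
  ultimately show False using \<open>k + 2 \<le> d\<close> by (simp add: algebra_simps)
qed

section \<open>Circulant graphs\<close>

text \<open>
  Connection sets of circulant graphs on the integers modulo \<open>N\<close>: \<open>d div 2\<close> residues on either
  side of zero and, for odd \<open>d\<close>, the self-inverse residue \<open>N div 2\<close>, which exists because \<open>N\<close> is
  then even. Containing \<open>1\<close> makes consecutive numbers adjacent.
\<close>

lemma ex_symmetric_connection_set:
  fixes d N :: nat
  assumes "2 \<le> d" "d < N" "even (d * N)"
  shows "\<exists>S \<subseteq> {1..<N}. 1 \<in> S \<and> (\<forall>s\<in>S. N - s \<in> S) \<and> card S = d"
proof -
  define r where "r = d div 2"
  have r: "1 \<le> r" "2 * r \<le> d" "d \<le> 2 * r + 1" using assms(1) by (auto simp: r_def)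
  define S where "S = {1..r} \<union> {N - r..<N}"
  have S: "S \<subseteq> {1..<N}" "1 \<in> S" "\<And>s. s \<in> S \<Longrightarrow> N - s \<in> S"
    using r assms(2) by (auto simp: S_def)
  have "{1..r} \<inter> {N - r..<N} = {}" using r assms(2) by auto
  then have cardS: "card S = 2 * r"
    unfolding S_def using r assms(2) by (subst card_Un_disjoint) auto
  show ?thesis
  proof (cases "even d")
    case True
    then have "card S = d" using cardS by (simp add: r_def)
    with S show ?thesis by blast
  next
    case False
    with assms(3) have "even N" by simp
    then obtain h where h: "N = 2 * h" by blast
    have d: "d = 2 * r + 1" using False by (auto simp: r_def)
    have "h \<notin> S" using h d assms(2) by (auto simp: S_def)
    then have "card (insert h S) = d" using cardS d by (simp add: S_def)
    moreover have "insert h S \<subseteq> {1..<N}" "\<forall>s\<in>insert h S. N - s \<in> insert h S"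
      using S h d assms(2) by auto
    ultimately show ?thesis using S(2) by blast
  qed
qed

text \<open>
  The witness is the circulant graph, moved to start at \<open>l\<close> so that two of them can be placed side
  by side on disjoint intervals.
\<close>

lemma ex_regular_hamiltonian:
  fixes d N l :: nat
  assumes "2 \<le> d" "d < N" "even (d * N)"
  shows "\<exists>R. R \<subseteq> {l..<l + N} \<times> {l..<l + N} \<and> sym R \<and> irrefl R \<and>
    (\<forall>v\<in>{l..<l + N}. card (R `` {v}) = d) \<and>
    (\<forall>i. l \<le> i \<and> Suc i < l + N \<longrightarrow> (i, Suc i) \<in> R) \<and> (l, l + N - 1) \<in> R"
proof -
  obtain S where S: "S \<subseteq> {1..<N}" "1 \<in> S" "\<And>s. s \<in> S \<Longrightarrow> N - s \<in> S" "card S = d"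
    using ex_symmetric_connection_set[OF assms] by blast
  define R where "R = {(l + i, l + (i + s) mod N) | i s. i < N \<and> s \<in> S}"
  have "0 < N" using assms by simp
  have "R \<subseteq> {l..<l + N} \<times> {l..<l + N}" using \<open>0 < N\<close> by (auto simp: R_def)
  moreover have "sym R"
  proof (rule symI)
    fix u v assume "(u, v) \<in> R"
    then obtain i s where ix: "i < N" "s \<in> S" "u = l + i" "v = l + (i + s) mod N"
      by (auto simp: R_def)
    have "s \<le> N" using ix S by force
    have "((i + s) mod N + (N - s)) mod N = (i + s + (N - s)) mod N" by (rule mod_add_left_eq)
    also have "\<dots> = i" using \<open>s \<le> N\<close> ix(1) by simp
    finally show "(v, u) \<in> R"
      unfolding R_def using ix S(3)[OF ix(2)] \<open>0 < N\<close>
      by (intro CollectI exI[of _ "(i + s) mod N"] exI[of _ "N - s"]) simp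
  qed
  moreover have "irrefl R"
  proof (rule irreflI)
    fix u show "(u, u) \<notin> R"
    proof
      assume "(u, u) \<in> R"
      then obtain i s where ix: "i < N" "s \<in> S" "i = (i + s) mod N" by (auto simp: R_def)
      have "0 < s" "s < N" using S(1) ix(2) by auto
      with ix show False by (cases "i + s < N") (auto simp: le_mod_geq)
    qed
  qed
  moreover have "card (R `` {v}) = d" if "v \<in> {l..<l + N}" for v
  proof -
    define i where "i = v - l"
    have i: "i < N" "v = l + i" using that by (auto simp: i_def)
    have "R `` {v} = (\<lambda>s. l + (i + s) mod N) ` S" using i by (auto simp: R_def)
    moreover have "inj_on (\<lambda>s. l + (i + s) mod N) S"
    proof (rule inj_onI)
      fix s t assume "s \<in> S" "t \<in> S" and eq: "l + (i + s) mod N = l + (i + t) mod N"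
      then have "s < N" "t < N" using S(1) by auto
      with eq i show "s = t" by (auto simp: mod_if split: if_splits)
    qed
    ultimately show ?thesis using S(4) by (simp add: card_image)
  qed
  moreover have "(i, Suc i) \<in> R" if "l \<le> i \<and> Suc i < l + N" for i
    unfolding R_def using that S(2)
    by (intro CollectI exI[of _ "i - l"] exI[of _ 1]) auto
  moreover have "(l, l + N - 1) \<in> R"
    unfolding R_def using S(3)[OF S(2)] \<open>0 < N\<close>
    by (intro CollectI exI[of _ 0] exI[of _ "N - 1"]) auto
  ultimately show ?thesis by blast
qed

section \<open>Joining two regular graphs by a switch\<close>

text \<open>
  The degree-preserving switch of graph theory: two edges exchange their end points. Both
  orientations occur in each set because an edge is a pair of opposite arcs.
\<close>

definition switch :: "'a \<Rightarrow> 'a \<Rightarrow> 'a \<Rightarrow> 'a \<Rightarrow> 'a rel \<Rightarrow> 'a rel" where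
  "switch a a' b b' R =
     R - {(a, a'), (a', a), (b, b'), (b', b)} \<union> {(a, b), (b, a), (a', b'), (b', a')}"

lemma sym_switch: "sym R \<Longrightarrow> sym (switch a a' b b' R)"
  unfolding switch_def sym_def by blast

lemma card_Image_switch:
  assumes "sym R" and "(a, a') \<in> R" "(b, b') \<in> R" "(a, b) \<notin> R" "(a', b') \<notin> R"
    and "distinct [a, a', b, b']" and fin: "finite (R `` {v})"
  shows "card (switch a a' b b' R `` {v}) = card (R `` {v})"
proof -
  have exchange: "card (insert y (R `` {v} - {x})) = card (R `` {v})"
    if "(v, x) \<in> R" "(v, y) \<notin> R" for x y
    using that fin card_Suc_Diff1[of "R `` {v}" x] by simp
  have rev: "(a', a) \<in> R" "(b', b) \<in> R" "(b, a) \<notin> R" "(b', a') \<notin> R"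
    using assms(1-5) by (auto dest: symD)
  consider "v = a" | "v = a'" | "v = b" | "v = b'" | "v \<notin> {a, a', b, b'}" by blast
  then show ?thesis
  proof cases
    case 1
    then have "switch a a' b b' R `` {v} = insert b (R `` {v} - {a'})"
      using assms(6) by (auto simp: switch_def)
    then show ?thesis using 1 assms exchange[of a' b] by simp
  next
    case 2
    then have "switch a a' b b' R `` {v} = insert b' (R `` {v} - {a})"
      using assms(6) by (auto simp: switch_def)
    then show ?thesis using 2 assms rev exchange[of a b'] by simp
  next
    case 3
    then have "switch a a' b b' R `` {v} = insert a (R `` {v} - {b'})"
      using assms(6) by (auto simp: switch_def)
    then show ?thesis using 3 assms rev exchange[of b' a] by simp
  next
    case 4
    then have "switch a a' b b' R `` {v} = insert a' (R `` {v} - {b})"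
      using assms(6) by (auto simp: switch_def)
    then show ?thesis using 4 assms rev exchange[of b a'] by simp
  next
    case 5
    then have "switch a a' b b' R `` {v} = R `` {v}" by (auto simp: switch_def)
    then show ?thesis by simp
  qed
qed

lemma connected_if_consecutive_adjacent:
  fixes G :: "nat pair_pre_digraph"
  assumes "pair_graph G" and V: "pverts G = {..<n}" "0 < n"
    and path: "\<And>i. Suc i < n \<Longrightarrow> (i, Suc i) \<in> parcs G"
  shows "connected (with_proj G)"
proof -
  interpret pair_graph G by fact
  have up: "0 \<rightarrow>\<^sup>*\<^bsub>with_proj G\<^esub> i" if "i < n" for i
    using that
  proof (induction i)
    case 0
    then show ?case using V by (intro reachable_refl) simp
  next
    case (Suc i)
    then show ?case using path[of i] by (auto intro: reachable_adj_trans)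
  qed
  have "u \<rightarrow>\<^sup>*\<^bsub>with_proj G\<^esub> v" if "u < n" "v < n" for u v
    using symmetric_reachable'[OF up[OF that(1)]] up[OF that(2)] by (rule reachable_trans)
  then show ?thesis
    using V by (intro connectedI) (auto simp: reachable_mk_symmetric_eq[OF sym_arcs])
qed

text \<open>
  Two circulant graphs on \<open>{..<m}\<close> and \<open>{m..<n}\<close> are joined by switching the edges that close their
  Hamiltonian cycles. The path \<open>0, 1, \<dots>, n - 1\<close> survives in the result: its step from
  \<open>m - 1\<close> to \<open>m\<close> is one of the two new edges.
\<close>

lemma ex_regular_connected_with_small_cut:
  fixes d m n :: nat
  assumes "2 \<le> d" "d < m" "d < n - m" "even (d * m)" "even (d * n)"
  shows "\<exists>G. pair_graph G \<and> pverts G = {..<n} \<and> connected (with_proj G) \<and> regular d G \<and>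
    card {a \<in> parcs G. fst a < m \<and> \<not> snd a < m} \<le> 2"
proof -
  have mn: "3 \<le> m" "m + 3 \<le> n" using assms by auto
  have "even (d * (n - m))" using assms(4,5) by (simp add: diff_mult_distrib2)
  obtain A where A: "A \<subseteq> {..<m} \<times> {..<m}" "sym A" "irrefl A"
      "\<And>v. v < m \<Longrightarrow> card (A `` {v}) = d" "\<And>i. Suc i < m \<Longrightarrow> (i, Suc i) \<in> A" "(0, m - 1) \<in> A"
    using ex_regular_hamiltonian[of d m 0] assms by (auto simp: atLeast0LessThan)
  obtain B where B: "B \<subseteq> {m..<n} \<times> {m..<n}" "sym B" "irrefl B"
      "\<And>v. m \<le> v \<Longrightarrow> v < n \<Longrightarrow> card (B `` {v}) = d"
      "\<And>i. m \<le> i \<Longrightarrow> Suc i < n \<Longrightarrow> (i, Suc i) \<in> B" "(m, n - 1) \<in> B"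
    using ex_regular_hamiltonian[of d "n - m" m] assms mn \<open>even (d * (n - m))\<close> by auto
  define R where "R = switch 0 (m - 1) (n - 1) m (A \<union> B)"
  define G where "G = \<lparr>pverts = {..<n}, parcs = R\<rparr>"
  have AB: "A \<union> B \<subseteq> {..<n} \<times> {..<n}" using A(1) B(1) mn by fastforce
  then have R: "R \<subseteq> {..<n} \<times> {..<n}" using mn by (auto simp: R_def switch_def)
  then have finR: "finite R" by (rule finite_subset) simp
  have "sym (A \<union> B)" using A(2) B(2) by (rule sym_Un)
  then have "sym R" unfolding R_def by (rule sym_switch)
  have irrefl: "(v, v) \<notin> R" for v
    using A(3) B(3) mn by (auto simp: R_def switch_def irrefl_def)
  have "pair_graph G"
  proof
    show "symmetric (with_proj G)" using \<open>sym R\<close> by (simp add: symmetric_def G_def)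
  qed (use R finR irrefl in \<open>auto simp: G_def\<close>)
  moreover have "regular d G"
  proof -
    have "card (R `` {v}) = d" if "v < n" for v
    proof -
      have "card (R `` {v}) = card ((A \<union> B) `` {v})"
        unfolding R_def
      proof (rule card_Image_switch[OF \<open>sym (A \<union> B)\<close>])
        show "(n - 1, m) \<in> A \<union> B" using B(2,6) by (auto dest: symD)
        show "finite ((A \<union> B) `` {v})"
          using finite_subset[OF AB] by (simp add: finite_Image)
        show "(0, n - 1) \<notin> A \<union> B" "(m - 1, m) \<notin> A \<union> B"
          using A(1) B(1) mn by force+
      qed (use A(6) mn in auto)
      also have "\<dots> = d"
      proof (cases "v < m")
        case True
        then have "(A \<union> B) `` {v} = A `` {v}" using B(1) by auto
        then show ?thesis using A(4) True by simp
      next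
        case False
        then have "(A \<union> B) `` {v} = B `` {v}" using A(1) by auto
        then show ?thesis using B(4) False that by simp
      qed
      finally show ?thesis .
    qed
    moreover have "out_degree (with_proj G) v = card (R `` {v})" for v
    proof -
      have "out_arcs (with_proj G) v = Pair v ` (R `` {v})" by (auto simp: out_arcs_def G_def)
      then show ?thesis by (simp add: out_degree_def card_image inj_on_def)
    qed
    ultimately show ?thesis by (simp add: regular_def G_def)
  qed
  moreover have "connected (with_proj G)"
  proof (rule connected_if_consecutive_adjacent[OF \<open>pair_graph G\<close>, of n])
    fix i assume i: "Suc i < n"
    consider "Suc i < m" | "Suc i = m" | "m \<le> i" by linarith
    then show "(i, Suc i) \<in> parcs G"
    proof cases
      case 1
      then show ?thesis using A(5) mn by (auto simp: G_def R_def switch_def)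
    next
      case 2
      then show ?thesis by (auto simp: G_def R_def switch_def)
    next
      case 3
      then show ?thesis using B(5) i mn by (auto simp: G_def R_def switch_def)
    qed
  qed (use mn in \<open>auto simp: G_def\<close>)
  moreover have "card {a \<in> parcs G. fst a < m \<and> \<not> snd a < m} \<le> 2"
  proof -
    have "{a \<in> parcs G. fst a < m \<and> \<not> snd a < m} \<subseteq> {(0, n - 1), (m - 1, m)}"
    proof (rule subsetI)
      fix a assume "a \<in> {a \<in> parcs G. fst a < m \<and> \<not> snd a < m}"
      then have a: "a \<in> R" "fst a < m" "\<not> snd a < m" by (simp_all add: G_def)
      then have "a \<notin> A \<union> B" using A(1) B(1) by auto
      with a(1) have "a \<in> {(0, n - 1), (n - 1, 0), (m - 1, m), (m, m - 1)}"
        by (simp add: R_def switch_def)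
      then show "a \<in> {(0, n - 1), (m - 1, m)}" using a(2,3) by auto
    qed
    then have "card {a \<in> parcs G. fst a < m \<and> \<not> snd a < m} \<le> card {(0, n - 1), (m - 1, m)}"
      by (intro card_mono) auto
    also have "\<dots> \<le> 2" using card_length[of "[(0, n - 1), (m - 1, m)]"] by simp
    finally show ?thesis .
  qed
  moreover have "pverts G = {..<n}" by (simp add: G_def)
  ultimately show ?thesis by blast
qed

theorem theorem2:
  fixes d n :: nat
  assumes "even (d * n)" and "d \<ge> 5" and "n \<ge> 2 * d + 3"
  shows "\<exists>G :: nat pair_pre_digraph.
           pair_graph G \<and> card (pverts G) = n \<and> connected (with_proj G) \<and> regular d G \<and>
           acyclic_chromatic_index G \<ge> d + 2"
proof -
  define k where "k = d div 2 + 1"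
  have k: "d < 2 * k" "2 * k \<le> d + 2" "k + 2 \<le> d" "0 < k"
    using assms(2) by (auto simp: k_def)
  have "even (d * (2 * k))" "d < n - 2 * k" using k assms(3) by auto
  then obtain G where G: "pair_graph G" "pverts G = {..<n}" "connected (with_proj G)" "regular d G"
    "card {a \<in> parcs G. fst a < 2 * k \<and> \<not> snd a < 2 * k} \<le> 2"
    using ex_regular_connected_with_small_cut[of d "2 * k" n] assms(1,2) k(1) by auto
  have "d + 2 \<le> acyclic_chromatic_index G"
    by (rule acyclic_chromatic_index_ge_if_small_cut[OF G(1,4), of "{..<2 * k}" k])
      (use G(2,5) k assms(3) in auto)
  with G show ?thesis by auto
qed

end
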